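(* Let $c>0$ and $\delta>0$ be real constants. There exists a bijection between the set of continuous distribution functions $F\in\mathbf{P}_{c,\delta}$ with $\mathrm{supp}(F)=[0,\infty)$ and the set of positive solutions $y$ (that is, $y(t)>0$ for all $t\ge0$) of the delay differential initial value problem $$y'(t)+cy(t-\delta)=0,\ t\ge\delta;\qquad y(t)=\varphi(t),\ t\in[0,\delta],$$ with initial function $\varphi\in\Phi$. The bijection is given by $F=1-y$ (on $[0,\infty)$, with $F=0$ on $(-\infty,0)$). In particular, there exists a continuous $F\in\mathbf{P}_{c,\delta}$ with $\mathrm{supp}(F)=[0,\infty)$ if and only if $c\delta\le 1/e$.
   Context: Let $(X_n)_{n\ge1}$ be independent, identically distributed, integrable real random variables with non-degenerate distribution function $F$. Put $\mathcal{F}_n=\sigma(X_1,\ldots,X_n)$ and $M_n=\max\{X_1,\ldots,X_n\}$. For a real $\delta\neq0$ let $I_1=1$ and, for $n\ge2$, let $I_n=1$ if $X_n>M_{n-1}+\delta$ and $I_n=0$ otherwise; let $N_n=\sum_{k=1}^n I_k$ (the number of $\delta$-records among the first $n$ observations). For real $c>0$ and $\delta\ne0$, write $F\in\mathbf{P}_{c,\delta}$ if $F$ is such a (non-degenerate, finite-mean) distribution function and $(N_n-cM_n)_{n\ge1}$ is an $(\mathcal{F}_n)$-martingale. The support is $\mathrm{supp}(F)=\{x\in\mathbb{R}:F(x+\epsilon)-F(x-\epsilon)>0\ \forall\epsilon>0\}$. $\Phi$ denotes the set of functions $\varphi:[0,\delta]\to\mathbb{R}$ that are continuous and strictly decreasing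 with $\varphi(0)=1$ and $\varphi(\delta)>0$. A solution of the initial value problem is a continuous function $y$ on $[0,\infty)$ with $y=\varphi$ on $[0,\delta]$ and $y'(t)=-cy(t-\delta)$ for $t\ge\delta$ (right derivative at $t=\delta$); equivalently $y(t)=y(s)-c\int_{s-\delta}^{t-\delta}y(x)\,dx$ for all $t\ge s\ge\delta$. For each $\varphi\in\Phi$ the solution exists and is unique. *)

theory Defs
  imports "HOL-Probability.Probability"
begin

(* Sequences X_1, X_2, ... are functions on nat of which only the values at n >= 1 matter. *)

definition nat_filtration :: "'a measure \<Rightarrow> (nat \<Rightarrow> 'a \<Rightarrow> real) \<Rightarrow> nat \<Rightarrow> 'a measure" where
  "nat_filtration M X n =
     sigma (space M) (\<Union>i\<in>{1..n}. {X i -` A \<inter> space M | A. A \<in> sets borel})"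

definition martingale ::
    "'a measure \<Rightarrow> (nat \<Rightarrow> 'a measure) \<Rightarrow> (nat \<Rightarrow> 'a \<Rightarrow> real) \<Rightarrow> bool" where
  "martingale M G Z \<longleftrightarrow>
     filtration (space M) G \<and> (\<forall>n\<ge>1. subalgebra M (G n)) \<and>
     (\<forall>n\<ge>1. Z n \<in> borel_measurable (G n)) \<and>
     (\<forall>n\<ge>1. integrable M (Z n)) \<and>
     (\<forall>n\<ge>1. AE w in M. real_cond_exp M (G n) (Z (Suc n)) w = Z n w)"

definition running_max :: "(nat \<Rightarrow> 'a \<Rightarrow> real) \<Rightarrow> nat \<Rightarrow> 'a \<Rightarrow> real" where
  "running_max X n w = Max ((\<lambda>i. X i w) ` {1..n})"

definition delta_record :: "real \<Rightarrow> (nat \<Rightarrow> 'a \<Rightarrow> real) \<Rightarrow> nat \<Rightarrow> 'a \<Rightarrow> real" where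
  "delta_record \<delta> X n w =
     (if n = 1 then 1 else if X n w > running_max X (n - 1) w + \<delta> then 1 else 0)"

definition num_delta_records :: "real \<Rightarrow> (nat \<Rightarrow> 'a \<Rightarrow> real) \<Rightarrow> nat \<Rightarrow> 'a \<Rightarrow> real" where
  "num_delta_records \<delta> X n w = (\<Sum>k=1..n. delta_record \<delta> X k w)"

definition degenerate :: "(real \<Rightarrow> real) \<Rightarrow> bool" where
  "degenerate F \<longleftrightarrow> (\<exists>a. \<forall>x. F x = (if a \<le> x then 1 else 0))"

definition iid_integrable :: "'a measure \<Rightarrow> (nat \<Rightarrow> 'a \<Rightarrow> real) \<Rightarrow> (real \<Rightarrow> real) \<Rightarrow> bool" where
  "iid_integrable M X F \<longleftrightarrow>
     prob_space M \<and> prob_space.indep_vars M (\<lambda>_. borel) X {1..} \<and>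
     (\<forall>n\<ge>1. cdf (distr M borel (X n)) = F) \<and> (\<forall>n\<ge>1. integrable M (X n))"

(* The martingale property depends only on the joint law of the X n, hence only on F. Sample
   spaces of type nat => real suffice, since the product space carries an iid sequence with
   distribution function F. *)
definition P_class :: "real \<Rightarrow> real \<Rightarrow> (real \<Rightarrow> real) set" where
  "P_class c \<delta> = {F. \<not> degenerate F \<and>
     (\<exists>(M :: (nat \<Rightarrow> real) measure) X. iid_integrable M X F \<and>
        martingale M (nat_filtration M X)
          (\<lambda>n w. num_delta_records \<delta> X n w - c * running_max X n w))}"

definition supp :: "(real \<Rightarrow> real) \<Rightarrow> real set" where
  "supp F = {x. \<forall>\<epsilon>>0. F (x + \<epsilon>) - F (x - \<epsilon>) > 0}"

(* Functions on [0,\<delta>] and on [0,\<infinity>) are represented by extensional functions on real, so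
   that each is represented exactly once. *)

definition init_funs :: "real \<Rightarrow> (real \<Rightarrow> real) set" where
  "init_funs \<delta> = {\<phi> \<in> extensional {0..\<delta>}. continuous_on {0..\<delta>} \<phi> \<and>
     strict_antimono_on {0..\<delta>} \<phi> \<and> \<phi> 0 = 1 \<and> \<phi> \<delta> > 0}"

(* The derivative within {\<delta>..} is the right derivative at \<delta> and the ordinary two-sided
   derivative at every t > \<delta>. *)
definition ivp_solution :: "real \<Rightarrow> real \<Rightarrow> (real \<Rightarrow> real) \<Rightarrow> (real \<Rightarrow> real) \<Rightarrow> bool" where
  "ivp_solution c \<delta> \<phi> y \<longleftrightarrow>
     y \<in> extensional {0..} \<and> continuous_on {0..} y \<and> (\<forall>t\<in>{0..\<delta>}. y t = \<phi> t) \<and>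
     (\<forall>t\<ge>\<delta>. (y has_real_derivative - c * y (t - \<delta>)) (at t within {\<delta>..}))"

definition positive_solutions :: "real \<Rightarrow> real \<Rightarrow> (real \<Rightarrow> real) set" where
  "positive_solutions c \<delta> =
     {y. (\<exists>\<phi>\<in>init_funs \<delta>. ivp_solution c \<delta> \<phi> y) \<and> (\<forall>t\<ge>0. y t > 0)}"

end

theory Submission
  imports Defs
begin

text \<open>Let \<open>S = 1 - F\<close> and let \<open>\<mu>\<close> be the law of \<open>X\<^sub>1\<close>. Given the first \<open>n\<close> observations, the expected
  increment of \<open>N - c M\<close> depends only on \<open>m = M\<^sub>n\<close>: the next observation is a \<open>\<delta>\<close>-record with
  probability \<open>S (m + \<delta>)\<close>, and it raises the maximum by \<open>E (X - m)\<^sup>+\<close> on average. So the martingale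
  property says that \<open>S (m + \<delta>) = c E (X - m)\<^sup>+\<close> for almost every value \<open>m\<close> of each \<open>M\<^sub>n\<close>
  (lemma \<open>martingale_iff_drift_zero\<close>). If \<open>F\<close> is continuous, both sides are continuous in \<open>m\<close>, and
  the case \<open>n = 1\<close> gives the equation on the whole support \<open>[0, \<infinity>)\<close>. Conversely, the equation on
  \<open>[0, \<infinity>)\<close> suffices if \<open>X \<ge> 0\<close> almost surely.

  The mean excess \<open>E (X - m)\<^sup>+\<close> is the integral of \<open>S\<close> over \<open>[m, \<infinity>)\<close>, so its derivative is \<open>- S m\<close>.
  Differentiating the equation gives \<open>S' t = - c S (t - \<delta>)\<close> for \<open>t \<ge> \<delta>\<close>, and \<open>S\<close> is positive and strictly
  decreasing because the support is \<open>[0, \<infinity>)\<close>. In the other direction, a positive solution \<open>y\<close> decreases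
  strictly to \<open>0\<close>, so \<open>F = 1 - y\<close> is a distribution function. Integrating the differential
  equation recovers the drift equation, once \<open>\<mu>\<close> is known to have a mean. Both steps are made with the
  truncated mean \<open>E (min X b - min X 0)\<close>. It exists for every law, its derivative is \<open>S b\<close>, and so
  \<open>y (b + \<delta>) + c E (min X b - min X 0)\<close> is constant for \<open>b \<ge> 0\<close>. Letting \<open>b\<close> tend to infinity, monotone convergence
  yields the mean.

  For the existence criterion, \<open>exp (- k t)\<close> solves the equation if \<open>k exp (- k \<delta>) = c\<close>, and the
  left-hand side attains its maximum \<open>1 / (e \<delta>)\<close> at \<open>k = 1 / \<delta>\<close>. If \<open>c \<delta> > 1 / e\<close>, consider
  the ratio \<open>y (t - \<delta>) / y t\<close> of a positive decreasing solution. A lower bound \<open>a\<close> for it improves to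
  \<open>exp (c a \<delta>) \<ge> (e c \<delta>) a\<close> one delay later, so the ratio would be unbounded; but it is at most
  \<open>(2 / (c \<delta>))\<^sup>2\<close>.\<close>

section \<open>The drift of the record martingale\<close>

lemma space_nat_filtration [simp]: "space (nat_filtration M X n) = space M"
  by (simp add: nat_filtration_def space_measure_of_conv)

lemma sets_nat_filtration_sigma:
  "sets (nat_filtration M X n) =
     sigma_sets (space M) (\<Union>i\<in>{1..n}. {X i -` A \<inter> space M |A. A \<in> sets borel})"
  unfolding nat_filtration_def by (rule sets_measure_of) auto

lemma nat_filtration_measurable:
  assumes "i \<in> {1..n}"
  shows "X i \<in> borel_measurable (nat_filtration M X n)"
proof (rule measurableI)
  fix A :: "real set" assume "A \<in> sets borel"
  with assms show "X i -` A \<inter> space (nat_filtration M X n) \<in> sets (nat_filtration M X n)"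
    unfolding sets_nat_filtration_sigma space_nat_filtration
    by (intro sigma_sets.Basic) blast
qed simp

lemma filtration_nat_filtration: "filtration (space M) (nat_filtration M X)"
proof
  fix m n :: nat assume "m \<le> n"
  then have "{1..m} \<subseteq> {1..n}" by auto
  then show "sets (nat_filtration M X m) \<subseteq> sets (nat_filtration M X n)"
    unfolding sets_nat_filtration_sigma by (intro sigma_sets_mono' UN_mono) auto
qed simp

lemma subalgebra_nat_filtration:
  assumes "\<And>i. i \<in> {1..n} \<Longrightarrow> X i \<in> borel_measurable M"
  shows "subalgebra M (nat_filtration M X n)"
proof -
  have "(\<Union>i\<in>{1..n}. {X i -` A \<inter> space M |A. A \<in> sets borel}) \<subseteq> sets M"
    using assms by (auto intro: measurable_sets)
  then show ?thesis
    unfolding subalgebra_def sets_nat_filtration_sigma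
    using sets.sigma_sets_subset by simp
qed

text \<open>The past is generated by the finite vector \<open>(X\<^sub>1, \<dots>, X\<^sub>n)\<close>. In this form each event of the past is
  the preimage of a set of vectors, which makes the independence of the next observation usable.\<close>
lemma sets_nat_filtration:
  "sets (nat_filtration M X n) =
     sets (vimage_algebra (space M) (\<lambda>w. \<lambda>i\<in>{1..n}. X i w) (PiM {1..n} (\<lambda>_. borel)))"
  (is "sets ?G = sets (vimage_algebra _ ?V ?N)")
proof
  have "?V \<in> measurable ?G ?N"
    by (intro measurable_restrict nat_filtration_measurable)
  then show "sets (vimage_algebra (space M) ?V ?N) \<subseteq> sets ?G"
    using sets_image_in_sets space_nat_filtration by metis
  have V: "?V \<in> measurable (vimage_algebra (space M) ?V ?N) ?N"
    by (rule measurable_vimage_algebra1) (auto simp: space_PiM)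
  have "X i -` A \<inter> space M \<in> sets (vimage_algebra (space M) ?V ?N)"
    if i: "i \<in> {1..n}" and A: "A \<in> sets borel" for i and A :: "real set"
  proof -
    have "(\<lambda>w. ?V w i) \<in> borel_measurable (vimage_algebra (space M) ?V ?N)"
      by (rule measurable_compose[OF V measurable_component_singleton]) (rule i)
    from measurable_sets[OF this A] show ?thesis
      using i by (simp add: restrict_def)
  qed
  then have "(\<Union>i\<in>{1..n}. {X i -` A \<inter> space M |A. A \<in> sets borel})
      \<subseteq> sets (vimage_algebra (space M) ?V ?N)"
    by blast
  from sets.sigma_sets_subset[OF this] show "sets ?G \<subseteq> sets (vimage_algebra (space M) ?V ?N)"
    by (simp only: sets_nat_filtration_sigma space_vimage_algebra)
qed

text \<open>Conditioning on \<open>V\<close> freezes it: what remains is the integral over the law of the independent \<open>X\<close>.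
  This is Fubini's theorem for the joint law of \<open>V\<close> and \<open>X\<close>, which is a product measure.\<close>
lemma (in prob_space) real_cond_exp_indep_function:
  fixes h :: "'b \<times> 'b \<Rightarrow> real"
  assumes indep: "indep_var N V N' X"
    and sub: "subalgebra M G"
    and G: "sets G = sets (vimage_algebra (space M) V N)"
    and h [measurable]: "h \<in> borel_measurable (N \<Otimes>\<^sub>M N')"
    and int: "integrable M (\<lambda>w. h (V w, X w))"
  shows "AE w in M. real_cond_exp M G (\<lambda>w. h (V w, X w)) w
                    = (\<integral>x. h (V w, x) \<partial>distr M N' X)"
proof -
  have V [measurable]: "V \<in> measurable M N" and X [measurable]: "X \<in> measurable M N'"
    and prod: "distr M N V \<Otimes>\<^sub>M distr M N' X = distr M (N \<Otimes>\<^sub>M N') (\<lambda>w. (V w, X w))"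
    using indep by (auto simp: indep_var_distribution_eq)
  interpret finite_measure_subalgebra M G
    using sub by unfold_locales
  interpret DV: prob_space "distr M N V" by (rule prob_space_distr) simp
  interpret DX: prob_space "distr M N' X" by (rule prob_space_distr) simp
  interpret P: pair_prob_space "distr M N V" "distr M N' X" ..
  let ?g = "\<lambda>v. \<integral>x. h (v, x) \<partial>distr M N' X"
  have g [measurable]: "?g \<in> borel_measurable N"
    by (rule DX.borel_measurable_lebesgue_integral) simp
  have spaceG: "space G = space M"
    using sub by (simp add: subalgebra_def)
  have VG: "V \<in> measurable G N"
  proof -
    have "V \<in> measurable (vimage_algebra (space M) V N) N"
      by (rule measurable_vimage_algebra1) (use measurable_space[OF V] in auto)
    then show ?thesis
      using G by (metis measurable_cong_sets)
  qed
  have int_prod: "integrable (distr M N V \<Otimes>\<^sub>M distr M N' X) h"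
    using int by (simp add: prod integrable_distr_eq)
  have int_g: "integrable M (\<lambda>w. ?g (V w))"
    using P.integrable_fst'[OF int_prod] by (simp add: integrable_distr_eq)
  show ?thesis
  proof (rule real_cond_exp_charact)
    fix A assume "A \<in> sets G"
    then obtain B where B [measurable]: "B \<in> sets N" and A: "A = V -` B \<inter> space M"
      unfolding G by (auto simp: sets_vimage_algebra2[OF measurable_space[OF V, THEN funcsetI]])
    let ?f = "\<lambda>z. indicator B (fst z) * h z"
    have int_f: "integrable (distr M N V \<Otimes>\<^sub>M distr M N' X) ?f"
      by (rule Bochner_Integration.integrable_bound[OF int_prod])
        (auto split: split_indicator)
    have "(\<integral>w\<in>A. h (V w, X w) \<partial>M) = (\<integral>w. ?f (V w, X w) \<partial>M)"
      unfolding set_lebesgue_integral_def A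
      by (rule Bochner_Integration.integral_cong) (auto split: split_indicator)
    also have "\<dots> = (\<integral>z. ?f z \<partial>(distr M N V \<Otimes>\<^sub>M distr M N' X))"
      by (simp add: prod integral_distr)
    also have "\<dots> = (\<integral>v. \<integral>x. ?f (v, x) \<partial>distr M N' X \<partial>distr M N V)"
      using P.integral_fst'[OF int_f] by simp
    also have "\<dots> = (\<integral>v. indicator B v * ?g v \<partial>distr M N V)"
      by simp
    also have "\<dots> = (\<integral>w. indicator B (V w) * ?g (V w) \<partial>M)"
      by (rule integral_distr) simp_all
    also have "\<dots> = (\<integral>w\<in>A. ?g (V w) \<partial>M)"
      unfolding set_lebesgue_integral_def A
      by (rule Bochner_Integration.integral_cong) (auto split: split_indicator)
    finally show "(\<integral>w\<in>A. h (V w, X w) \<partial>M) = (\<integral>w\<in>A. ?g (V w) \<partial>M)" .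
  qed (use int int_g measurable_compose[OF VG g] in auto)
qed

lemma running_max_Suc:
  "n \<ge> 1 \<Longrightarrow> running_max X (Suc n) w = max (running_max X n w) (X (Suc n) w)"
  by (simp add: running_max_def atLeastAtMostSuc_conv max.commute)

lemma num_delta_records_Suc:
  "num_delta_records \<delta> X (Suc n) w = num_delta_records \<delta> X n w + delta_record \<delta> X (Suc n) w"
  by (simp add: num_delta_records_def)

lemma running_max_measurable:
  "(\<And>i. i \<in> {1..n} \<Longrightarrow> X i \<in> borel_measurable M) \<Longrightarrow> running_max X n \<in> borel_measurable M"
  unfolding running_max_def[abs_def] by (rule borel_measurable_Max) auto

lemma num_delta_records_measurable:
  assumes "\<And>i. i \<in> {1..n} \<Longrightarrow> X i \<in> borel_measurable M"
  shows "num_delta_records \<delta> X n \<in> borel_measurable M"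
  unfolding num_delta_records_def[abs_def]
proof (rule borel_measurable_sum)
  fix k assume k: "k \<in> {1..n}"
  have [measurable]: "X k \<in> borel_measurable M" "running_max X (k - 1) \<in> borel_measurable M"
    using assms k by (auto intro!: running_max_measurable)
  show "delta_record \<delta> X k \<in> borel_measurable M"
    unfolding delta_record_def[abs_def] by measurable
qed

lemma iid_distr_eq:
  assumes iid: "iid_integrable M X F" and n: "n \<ge> 1"
  shows "distr M borel (X n) = distr M borel (X 1)"
proof (rule cdf_unique)
  interpret prob_space M using iid by (simp add: iid_integrable_def)
  have X: "X n \<in> borel_measurable M" if "n \<ge> 1" for n
    using iid that by (auto simp: iid_integrable_def intro: borel_measurable_integrable)
  show "real_distribution (distr M borel (X n))" "real_distribution (distr M borel (X 1))"
    using X n by auto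
  show "cdf (distr M borel (X n)) = cdf (distr M borel (X 1))"
    using iid n by (simp add: iid_integrable_def)
qed

text \<open>In the drift equation, \<open>1 - F (M\<^sub>n + \<delta>)\<close> is the conditional probability of a \<open>\<delta>\<close>-record at time
  \<open>n + 1\<close>, and the integral is the conditional mean of \<open>M\<^sub>n\<^sub>+\<^sub>1 - M\<^sub>n\<close>; the martingale property balances them.\<close>
lemma martingale_iff_drift_zero:
  assumes iid: "iid_integrable M X F"
  shows "martingale M (nat_filtration M X)
           (\<lambda>n w. num_delta_records \<delta> X n w - c * running_max X n w)
     \<longleftrightarrow> (\<forall>n\<ge>1. AE w in M. 1 - F (running_max X n w + \<delta>)
            = c * (\<integral>x. max 0 (x - running_max X n w) \<partial>distr M borel (X 1)))"
proof -
  interpret prob_space M using iid by (simp add: iid_integrable_def)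
  have indep: "indep_vars (\<lambda>_. borel) X {1..}" and X_int: "\<And>n. n \<ge> 1 \<Longrightarrow> integrable M (X n)"
    and F: "F = cdf (distr M borel (X 1))"
    using iid by (auto simp: iid_integrable_def)
  then have X [measurable]: "\<And>n. n \<ge> 1 \<Longrightarrow> X n \<in> borel_measurable M"
    by auto
  define \<mu> where "\<mu> = distr M borel (X 1)"
  interpret \<mu>: real_distribution \<mu>
    unfolding \<mu>_def using X[of 1] by simp
  have \<mu>_int: "integrable \<mu> (\<lambda>x. x)"
    unfolding \<mu>_def using X_int[of 1] X[of 1] by (simp add: integrable_distr_eq)
  let ?G = "nat_filtration M X"
  let ?Z = "\<lambda>n w. num_delta_records \<delta> X n w - c * running_max X n w"
  let ?d = "\<lambda>n w. (1 - F (running_max X n w + \<delta>)) - c * (\<integral>x. max 0 (x - running_max X n w) \<partial>\<mu>)"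
  have max_int: "integrable M (running_max X n)" if "n \<ge> 1" for n
    using that
  proof (induction n rule: dec_induct)
    case base
    then show ?case using X_int[of 1] by (simp add: running_max_def[abs_def])
  next
    case (step n)
    then show ?case
      using X_int[of "Suc n"]
      by (subst Bochner_Integration.integrable_cong[OF refl running_max_Suc]) simp_all
  qed
  have num_int: "integrable M (num_delta_records \<delta> X n)" for n
  proof (rule integrable_const_bound)
    show "AE w in M. norm (num_delta_records \<delta> X n w) \<le> real n"
    proof (rule AE_I2)
      fix w
      have "\<bar>num_delta_records \<delta> X n w\<bar> \<le> (\<Sum>k=1..n. \<bar>delta_record \<delta> X k w\<bar>)"
        unfolding num_delta_records_def by (rule sum_abs)
      also have "\<dots> \<le> (\<Sum>k=1..n. 1)"
        by (intro sum_mono) (simp add: delta_record_def)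
      finally show "norm (num_delta_records \<delta> X n w) \<le> real n" by simp
    qed
  qed (rule num_delta_records_measurable, auto intro: X)
  have Z_int: "integrable M (?Z n)" if "n \<ge> 1" for n
    using max_int[OF that] num_int by simp
  have Z_meas: "?Z n \<in> borel_measurable (?G n)" for n
    by (intro borel_measurable_diff borel_measurable_times borel_measurable_const
        num_delta_records_measurable running_max_measurable nat_filtration_measurable)
  have sub: "subalgebra M (?G n)" for n
    by (rule subalgebra_nat_filtration) (simp add: X)
  have drift: "AE w in M. real_cond_exp M (?G n) (?Z (Suc n)) w = ?Z n w + ?d n w"
    if n: "n \<ge> 1" for n
  proof -
    interpret finite_measure_subalgebra M "?G n"
      using sub by unfold_locales
    \<comment> \<open>\<open>indep_var\<close> relates variables of one type, so the next observation is carried as a vector with one entry.\<close>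
    let ?V = "\<lambda>w. \<lambda>i\<in>{1..n}. X i w" and ?U = "\<lambda>w. \<lambda>i\<in>{Suc n}. X i w"
    let ?N = "PiM {1..n} (\<lambda>_. borel) :: (nat \<Rightarrow> real) measure"
      and ?N' = "PiM {Suc n} (\<lambda>_. borel) :: (nat \<Rightarrow> real) measure"
    let ?r = "running_max (\<lambda>i v. v i) n :: (nat \<Rightarrow> real) \<Rightarrow> real"
    define h0 :: "real \<Rightarrow> real \<Rightarrow> real"
      where "h0 m x = (if x > m + \<delta> then 1 else 0) - c * max 0 (x - m)" for m x
    define h where "h = (\<lambda>(v, u). h0 (?r v) (u (Suc n)))"
    have indep_VU: "indep_var ?N ?V ?N' ?U"
      by (rule indep_var_restrict[OF indep]) auto
    have r [measurable]: "?r \<in> borel_measurable ?N"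
      by (rule running_max_measurable) simp
    have rV: "?r (?V w) = running_max X n w" for w
      unfolding running_max_def by (rule arg_cong[of _ _ Max]) auto
    have h [measurable]: "h \<in> borel_measurable (?N \<Otimes>\<^sub>M ?N')"
      unfolding h_def h0_def by measurable
    have hVU: "h (?V w, ?U w) = ?Z (Suc n) w - ?Z n w" for w
      using n by (simp add: h_def h0_def rV[simplified] num_delta_records_Suc running_max_Suc
          delta_record_def max_def algebra_simps)
    have U: "?U \<in> measurable M ?N'"
      using indep_VU by (auto simp: indep_var_distribution_eq)
    have \<mu>U: "(\<integral>u. h (v, u) \<partial>distr M ?N' ?U) = (1 - F (?r v + \<delta>)) - c * (\<integral>x. max 0 (x - ?r v) \<partial>\<mu>)"
      if "v \<in> space ?N" for v
    proof -
      have hv: "(\<lambda>u. h (v, u)) \<in> borel_measurable ?N'"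
        using that by measurable
      have "(\<integral>u. h (v, u) \<partial>distr M ?N' ?U) = (\<integral>w. h0 (?r v) (X (Suc n) w) \<partial>M)"
        by (subst integral_distr[OF U hv]) (simp add: h_def)
      also have "\<dots> = (\<integral>x. h0 (?r v) x \<partial>distr M borel (X (Suc n)))"
        by (rule integral_distr[symmetric]) (simp_all add: h0_def X)
      also have "\<dots> = (\<integral>x. h0 (?r v) x \<partial>\<mu>)"
        using iid_distr_eq[OF iid, of "Suc n"] by (simp add: \<mu>_def)
      also have "\<dots> = (\<integral>x. indicator {?r v + \<delta><..} x \<partial>\<mu>) - c * (\<integral>x. max 0 (x - ?r v) \<partial>\<mu>)"
      proof -
        have "(\<integral>x. h0 (?r v) x \<partial>\<mu>)
            = (\<integral>x. indicator {?r v + \<delta><..} x - c * max 0 (x - ?r v) \<partial>\<mu>)"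
          by (rule Bochner_Integration.integral_cong) (auto simp: h0_def)
        also have "\<dots> = (\<integral>x. indicator {?r v + \<delta><..} x \<partial>\<mu>) - (\<integral>x. c * max 0 (x - ?r v) \<partial>\<mu>)"
          using \<mu>_int
          by (intro Bochner_Integration.integral_diff) (auto simp: less_top[symmetric])
        finally show ?thesis by simp
      qed
      also have "(\<integral>x. indicator {?r v + \<delta><..} x \<partial>\<mu>) = 1 - F (?r v + \<delta>)"
      proof -
        have "UNIV - {..?r v + \<delta>} = {?r v + \<delta><..}" by auto
        then show ?thesis
          using \<mu>.prob_compl[of "{..?r v + \<delta>}"] by (simp add: F \<mu>_def cdf_def)
      qed
      finally show ?thesis .
    qed
    have hVU_int: "integrable M (\<lambda>w. h (?V w, ?U w))"
      unfolding hVU by (rule Bochner_Integration.integrable_diff[OF Z_int Z_int[OF n]]) simp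
    have "AE w in M. real_cond_exp M (?G n) (\<lambda>w. h (?V w, ?U w)) w
                    = (\<integral>u. h (?V w, u) \<partial>distr M ?N' ?U)"
      by (rule real_cond_exp_indep_function[OF indep_VU sub sets_nat_filtration h hVU_int])
    moreover have "(\<integral>u. h (?V w, u) \<partial>distr M ?N' ?U) = ?d n w" for w
      using \<mu>U[of "?V w", unfolded rV] by (simp add: space_PiM)
    moreover have "AE w in M. real_cond_exp M (?G n) (\<lambda>w. ?Z n w + h (?V w, ?U w)) w
        = real_cond_exp M (?G n) (?Z n) w + real_cond_exp M (?G n) (\<lambda>w. h (?V w, ?U w)) w"
      by (rule real_cond_exp_add[OF Z_int[OF n] hVU_int])
    moreover have "AE w in M. real_cond_exp M (?G n) (?Z n) w = ?Z n w"
      by (rule real_cond_exp_F_meas[OF Z_int[OF n] Z_meas])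
    moreover have "(\<lambda>w. ?Z n w + h (?V w, ?U w)) = ?Z (Suc n)"
      unfolding hVU by simp
    ultimately show ?thesis by auto
  qed
  have "martingale M ?G ?Z \<longleftrightarrow>
      (\<forall>n\<ge>1. AE w in M. real_cond_exp M (?G n) (?Z (Suc n)) w = ?Z n w)"
    unfolding martingale_def using filtration_nat_filtration sub Z_meas Z_int by blast
  also have "\<dots> \<longleftrightarrow> (\<forall>n\<ge>1. AE w in M. ?d n w = 0)"
  proof (intro all_cong iffI)
    fix n :: nat assume n: "n \<ge> 1"
    assume "AE w in M. real_cond_exp M (?G n) (?Z (Suc n)) w = ?Z n w"
    with drift[OF n] show "AE w in M. ?d n w = 0" by eventually_elim linarith
  next
    fix n :: nat assume n: "n \<ge> 1"
    assume "AE w in M. ?d n w = 0"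
    with drift[OF n] show "AE w in M. real_cond_exp M (?G n) (?Z (Suc n)) w = ?Z n w"
      by eventually_elim linarith
  qed
  finally show ?thesis by (simp add: \<mu>_def)
qed

section \<open>Truncated means and mean excess\<close>

text \<open>Such a \<open>T\<close> is an antiderivative of the non-increasing function \<open>f\<close>. The bounds allow \<open>T\<close> to be
  differentiated without representing it as an integral.\<close>
lemma has_real_derivative_if_secants_between:
  fixes f T :: "real \<Rightarrow> real"
  assumes cont: "isCont f x"
    and lo: "\<And>a b. a \<le> b \<Longrightarrow> (b - a) * f b \<le> T b - T a"
    and up: "\<And>a b. a \<le> b \<Longrightarrow> T b - T a \<le> (b - a) * f a"
  shows "(T has_real_derivative f x) (at x)"
proof -
  have "((\<lambda>z. (T z - T x) / (z - x)) \<longlongrightarrow> f x) (at x)"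
  proof (rule real_tendsto_sandwich)
    show "((\<lambda>z. min (f z) (f x)) \<longlongrightarrow> f x) (at x)" "((\<lambda>z. max (f z) (f x)) \<longlongrightarrow> f x) (at x)"
      using tendsto_min[OF cont[unfolded isCont_def] tendsto_const[of "f x"]]
        tendsto_max[OF cont[unfolded isCont_def] tendsto_const[of "f x"]] by simp_all
    have bnd: "min (f z) (f x) \<le> (T z - T x) / (z - x) \<and> (T z - T x) / (z - x) \<le> max (f z) (f x)"
      if "z \<noteq> x" for z
    proof (cases "x < z")
      case True
      then have "f z \<le> (T z - T x) / (z - x) \<and> (T z - T x) / (z - x) \<le> f x"
        using lo[of x z] up[of x z] by (simp add: pos_le_divide_eq pos_divide_le_eq mult.commute)
      then show ?thesis by auto
    next
      case False
      then have "z < x" using that by simp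
      moreover have "(T z - T x) / (z - x) = (T x - T z) / (x - z)"
        using that by (simp add: divide_simps) argo
      ultimately have "f x \<le> (T z - T x) / (z - x) \<and> (T z - T x) / (z - x) \<le> f z"
        using lo[of z x] up[of z x] by (simp add: pos_le_divide_eq pos_divide_le_eq mult.commute)
      then show ?thesis by auto
    qed
    show "\<forall>\<^sub>F z in at x. min (f z) (f x) \<le> (T z - T x) / (z - x)"
      "\<forall>\<^sub>F z in at x. (T z - T x) / (z - x) \<le> max (f z) (f x)"
      using bnd by (auto simp: eventually_at_filter intro!: always_eventually)
  qed
  then show ?thesis by (simp add: has_field_derivative_iff)
qed

context real_distribution
begin

text \<open>For \<open>b \<ge> 0\<close> this is the integral of \<open>1 - cdf M\<close> over \<open>[0, b]\<close>. Subtracting \<open>min x 0\<close> bounds the integrand,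
  so that the value is meaningful even if \<open>M\<close> has no mean.\<close>
definition truncated_mean :: "real \<Rightarrow> real" where
  "truncated_mean b = (\<integral>x. min x b - min x 0 \<partial>M)"

definition mean_excess :: "real \<Rightarrow> real" where
  "mean_excess m = (\<integral>x. max 0 (x - m) \<partial>M)"

lemma integrable_min_diff: "integrable M (\<lambda>x. min x b - min x a)"
  by (rule integrable_const_bound[of _ "\<bar>b - a\<bar>"]) (auto simp: min_def)

lemma truncated_mean_diff: "truncated_mean b - truncated_mean a = (\<integral>x. min x b - min x a \<partial>M)"
proof -
  have "truncated_mean b - truncated_mean a
      = (\<integral>x. (min x b - min x 0) - (min x a - min x 0) \<partial>M)"
    unfolding truncated_mean_def
    by (rule Bochner_Integration.integral_diff[symmetric]) (rule integrable_min_diff)+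
  then show ?thesis by simp
qed

lemma integral_tail: "(\<integral>x. k * indicator {b<..} x \<partial>M) = k * (1 - cdf M b)"
proof -
  have "UNIV - {..b} = {b<..}" by auto
  then show ?thesis
    using prob_compl[of "{..b}"] by (simp add: cdf_def)
qed

text \<open>For \<open>a \<le> b\<close> the integrand \<open>min x b - min x a\<close> lies between \<open>0\<close> and \<open>b - a\<close>, is \<open>0\<close> for
  \<open>x \<le> a\<close> and \<open>b - a\<close> for \<open>x > b\<close>.\<close>
lemma truncated_mean_secants:
  assumes "a \<le> b"
  shows "(b - a) * (1 - cdf M b) \<le> truncated_mean b - truncated_mean a"
    and "truncated_mean b - truncated_mean a \<le> (b - a) * (1 - cdf M a)"
proof -
  have int: "integrable M (\<lambda>x. (b - a) * indicator {m<..} x)" for m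
    by (auto simp: less_top[symmetric])
  show "(b - a) * (1 - cdf M b) \<le> truncated_mean b - truncated_mean a"
    unfolding truncated_mean_diff integral_tail[symmetric]
    by (rule integral_mono[OF int integrable_min_diff])
      (use assms in \<open>auto split: split_indicator simp: min_def\<close>)
  show "truncated_mean b - truncated_mean a \<le> (b - a) * (1 - cdf M a)"
    unfolding truncated_mean_diff integral_tail[symmetric]
    by (rule integral_mono[OF integrable_min_diff int])
      (use assms in \<open>auto split: split_indicator simp: min_def\<close>)
qed

lemma has_real_derivative_truncated_mean:
  assumes "isCont (cdf M) b"
  shows "(truncated_mean has_real_derivative 1 - cdf M b) (at b)"
  using assms truncated_mean_secants
  by (intro has_real_derivative_if_secants_between[where f = "\<lambda>b. 1 - cdf M b"]) auto

lemma truncated_mean_0 [simp]: "truncated_mean 0 = 0"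
  by (simp add: truncated_mean_def)

lemma mean_excess_eq:
  assumes "integrable M (\<lambda>x. x)"
  shows "mean_excess m = mean_excess 0 - truncated_mean m"
proof -
  have "mean_excess 0 - truncated_mean m = (\<integral>x. max 0 (x - 0) - (min x m - min x 0) \<partial>M)"
    unfolding mean_excess_def truncated_mean_def
    by (rule Bochner_Integration.integral_diff[symmetric, OF _ integrable_min_diff]) (use assms in auto)
  also have "\<dots> = mean_excess m"
    unfolding mean_excess_def
    by (rule Bochner_Integration.integral_cong) (auto simp: min_def max_def)
  finally show ?thesis by simp
qed

lemma has_real_derivative_mean_excess:
  assumes "integrable M (\<lambda>x. x)" "isCont (cdf M) m"
  shows "(mean_excess has_real_derivative - (1 - cdf M m)) (at m)"
proof -
  have eq: "mean_excess = (\<lambda>m. mean_excess 0 - truncated_mean m)"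
    using mean_excess_eq[OF assms(1)] by blast
  have "((\<lambda>m. mean_excess 0 - truncated_mean m) has_real_derivative 0 - (1 - cdf M m)) (at m)"
    by (intro DERIV_diff has_real_derivative_truncated_mean assms(2) DERIV_const)
  then show ?thesis by (subst eq) simp
qed

text \<open>On the nonnegative half-line the truncations increase to the identity, so monotone convergence
  turns a finite limit of the truncated means into the existence of the mean.\<close>
lemma truncated_mean_limit:
  assumes pos: "AE x in M. 0 \<le> x" and lim: "(truncated_mean \<longlongrightarrow> L) at_top"
  shows "integrable M (\<lambda>x. x)" and "mean_excess 0 = L"
proof -
  have lim_nat: "(\<lambda>n. truncated_mean (real n)) \<longlonglongrightarrow> L"
    using lim filterlim_real_sequentially by (rule filterlim_compose)
  have conv: "(\<lambda>n. min x (real n) - min x 0) \<longlonglongrightarrow> x - min x 0" for x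
  proof (rule tendsto_eventually)
    show "\<forall>\<^sub>F n in sequentially. min x (real n) - min x 0 = x - min x 0"
      using eventually_ge_at_top[of "nat \<lceil>x\<rceil>"] by eventually_elim (simp add: nat_ceiling_le_eq)
  qed
  have mono: "mono (\<lambda>n. min x (real n) - min x 0)" for x
    by (intro monoI) (auto simp: min_def)
  have "integrable M (\<lambda>x. x - min x 0) \<and> (\<integral>x. x - min x 0 \<partial>M) = L"
    using integral_monotone_convergence_nonneg[of M "\<lambda>n x. min x (real n) - min x 0" "\<lambda>x. x - min x 0" L,
        OF integrable_min_diff AE_I2[OF mono] AE_I2 AE_I2[OF conv] lim_nat[unfolded truncated_mean_def]]
    by (auto simp: min_def)
  moreover have "integrable M (\<lambda>x. x) \<longleftrightarrow> integrable M (\<lambda>x. x - min x 0)"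
    by (rule integrable_cong_AE) (use pos in auto)
  moreover have "mean_excess 0 = (\<integral>x. x - min x 0 \<partial>M)"
    unfolding mean_excess_def
    by (rule Bochner_Integration.integral_cong) (auto simp: min_def max_def)
  ultimately show "integrable M (\<lambda>x. x)" "mean_excess 0 = L" by auto
qed

end

section \<open>Positive solutions of the delay equation\<close>

lemma positive_solutionsD:
  assumes "y \<in> positive_solutions c \<delta>" and "\<delta> > 0"
  shows "y \<in> extensional {0..}" "continuous_on {0..} y" "strict_antimono_on {0..\<delta>} y" "y 0 = 1"
    and "\<And>t. t \<ge> 0 \<Longrightarrow> y t > 0"
    and "\<And>t. t > \<delta> \<Longrightarrow> (y has_real_derivative - c * y (t - \<delta>)) (at t)"
proof -
  obtain \<phi> where \<phi>: "\<phi> \<in> init_funs \<delta>" and y: "ivp_solution c \<delta> \<phi> y" "\<And>t. t \<ge> 0 \<Longrightarrow> y t > 0"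
    using assms by (auto simp: positive_solutions_def)
  show "y \<in> extensional {0..}" "continuous_on {0..} y"
    using y by (auto simp: ivp_solution_def)
  have eq: "\<And>t. t \<in> {0..\<delta>} \<Longrightarrow> y t = \<phi> t" using y by (auto simp: ivp_solution_def)
  show "strict_antimono_on {0..\<delta>} y"
    using \<phi> eq unfolding init_funs_def by (auto simp: monotone_on_def)
  show "y 0 = 1" using \<phi> eq[of 0] assms(2) by (simp add: init_funs_def)
  show "\<And>t. t \<ge> 0 \<Longrightarrow> y t > 0" by fact
  show "(y has_real_derivative - c * y (t - \<delta>)) (at t)" if "t > \<delta>" for t
  proof -
    have "at t within {\<delta>..} = at t"
      using that by (intro at_within_interior) simp
    then show ?thesis
      using y(1) that by (metis ivp_solution_def less_imp_le)
  qed
qed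

context
  fixes c \<delta> :: real and y :: "real \<Rightarrow> real"
  assumes c: "c > 0" and \<delta>: "\<delta> > 0"
    and cont: "continuous_on {0..} y"
    and pos: "\<And>t. t \<ge> 0 \<Longrightarrow> y t > 0"
    and deriv: "\<And>t. t > \<delta> \<Longrightarrow> (y has_real_derivative - c * y (t - \<delta>)) (at t)"
begin

lemma dde_mean_value:
  assumes "\<delta> \<le> a" "a < b"
  shows "\<exists>z. a < z \<and> z < b \<and> y b - y a = (b - a) * (- c * y (z - \<delta>))"
proof -
  have d: "(y has_real_derivative - c * y (t - \<delta>)) (at t)" if "a < t" for t
    using deriv[of t] that assms by simp
  have "\<exists>l z. a < z \<and> z < b \<and> (y has_real_derivative l) (at z) \<and> y b - y a = (b - a) * l"
  proof (rule MVT[OF assms(2)])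
    show "continuous_on {a..b} y"
      by (rule continuous_on_subset[OF cont]) (use assms \<delta> in auto)
    show "y differentiable (at t)" if "a < t" for t
      using d[OF that] real_differentiable_def by blast
  qed
  then show ?thesis using d DERIV_unique by metis
qed

lemma dde_strict_decreasing:
  assumes init: "strict_antimono_on {0..\<delta>} y" and "0 \<le> a" "a < b"
  shows "y b < y a"
proof -
  have late: "y b < y a" if ab: "\<delta> \<le> a" "a < b" for a b
  proof -
    obtain z where z: "a < z" "z < b" "y b - y a = (b - a) * (- c * y (z - \<delta>))"
      using dde_mean_value[OF ab] by blast
    have "(b - a) * (c * y (z - \<delta>)) > 0"
      using z ab c pos[of "z - \<delta>"] by simp
    then show ?thesis using z(3) by simp
  qed
  have early: "y b < y a" if "0 \<le> a" "a < b" "b \<le> \<delta>" for a b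
    using init that by (auto simp: monotone_on_def)
  consider "\<delta> \<le> a" | "b \<le> \<delta>" | "a < \<delta>" "\<delta> < b" by linarith
  then show ?thesis
  proof cases
    case 3
    then show ?thesis using late[of \<delta> b] early[of a \<delta>] assms by simp
  qed (use assms late early in auto)
qed

text \<open>Over a time span of \<open>\<delta> / 2\<close> starting at \<open>u\<close>, the solution loses at least
  \<open>c \<delta> / 2\<close> times \<open>y (u - \<delta> / 2)\<close>, and it cannot lose more than \<open>y u\<close>. Two such
  half-delay steps make up the full delay.\<close>
lemma dde_ratio_bounded:
  assumes dec: "\<And>a b. 0 \<le> a \<Longrightarrow> a \<le> b \<Longrightarrow> y b \<le> y a" and u: "u \<ge> 2 * \<delta>"
  shows "y (u - \<delta>) \<le> (2 / (c * \<delta>))\<^sup>2 * y u"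
proof -
  have half: "y (u - \<delta> / 2) \<le> 2 / (c * \<delta>) * y u" if u: "u \<ge> \<delta>" for u
  proof -
    obtain z where z: "u < z" "z < u + \<delta> / 2"
      "y (u + \<delta> / 2) - y u = (u + \<delta> / 2 - u) * (- c * y (z - \<delta>))"
      using dde_mean_value[of u "u + \<delta> / 2"] u \<delta> by force
    have "(c * \<delta> / 2) * y (u - \<delta> / 2) \<le> (c * \<delta> / 2) * y (z - \<delta>)"
      by (intro mult_left_mono dec) (use z that c \<delta> in auto)
    also have "\<dots> = y u - y (u + \<delta> / 2)"
      using z(3) by (simp add: algebra_simps)
    also have "\<dots> \<le> y u"
      using pos[of "u + \<delta> / 2"] that \<delta> by simp
    finally show ?thesis
      using c \<delta> by (simp add: field_simps)
  qed
  have "y (u - \<delta>) = y ((u - \<delta> / 2) - \<delta> / 2)" by simp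
  also have "\<dots> \<le> 2 / (c * \<delta>) * y (u - \<delta> / 2)"
    by (rule half) (use u \<delta> in simp)
  also have "\<dots> \<le> 2 / (c * \<delta>) * (2 / (c * \<delta>) * y u)"
    by (rule mult_left_mono[OF half]) (use u c \<delta> in simp_all)
  finally show ?thesis by (simp add: power2_eq_square mult.assoc)
qed

text \<open>If \<open>a y s \<le> y (s - \<delta>)\<close> then \<open>y' \<le> - c a y\<close>, so \<open>y s exp (c a s)\<close> does not increase. Over one delay
  this improves the factor \<open>a\<close> to \<open>exp (c a \<delta>)\<close>, which is at least \<open>e c a \<delta>\<close>.\<close>
lemma dde_ratio_growth:
  assumes dec: "\<And>a b. 0 \<le> a \<Longrightarrow> a \<le> b \<Longrightarrow> y b \<le> y a" and t: "t \<ge> (real n + 1) * \<delta>"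
  shows "(exp 1 * c * \<delta>) ^ n * y t \<le> y (t - \<delta>)"
  using t
proof (induction n arbitrary: t)
  case 0
  then show ?case using dec[of "t - \<delta>" t] \<delta> by simp
next
  case (Suc n)
  define a where "a = (exp 1 * c * \<delta>) ^ n"
  have a: "a > 0" using c \<delta> by (simp add: a_def)
  have t: "(real n + 1) * \<delta> \<le> t - \<delta>" using Suc.prems by (simp add: algebra_simps)
  then have t\<delta>: "\<delta> \<le> t - \<delta>" using \<delta> by (simp add: algebra_simps) (smt (verit) mult_nonneg_nonneg of_nat_0_le_iff)
  define g where "g s = y s * exp (c * a * s)" for s
  have "g t \<le> g (t - \<delta>)"
  proof (rule DERIV_nonpos_imp_decreasing_open[where f = g])
    show "continuous_on {t - \<delta>..t} g"
      unfolding g_def[abs_def]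
      by (intro continuous_intros continuous_on_subset[OF cont]) (use t\<delta> \<delta> in auto)
    fix s assume s: "t - \<delta> < s" "s < t"
    have "((\<lambda>s. exp (c * a * s)) has_real_derivative exp (c * a * s) * (c * a)) (at s)"
      by (auto intro!: derivative_eq_intros)
    from DERIV_mult[OF deriv this] have "(g has_real_derivative
        (- c * y (s - \<delta>)) * exp (c * a * s) + exp (c * a * s) * (c * a) * y s) (at s)"
      unfolding g_def[abs_def] using s t\<delta> by simp
    moreover have "a * y s \<le> y (s - \<delta>)"
      unfolding a_def by (rule Suc.IH) (use s t in simp)
    then have "c * exp (c * a * s) * (a * y s - y (s - \<delta>)) \<le> 0"
      using c by (intro mult_nonneg_nonpos) auto
    ultimately show "\<exists>l. (g has_real_derivative l) (at s) \<and> l \<le> 0"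
      by (intro exI conjI) (auto simp: algebra_simps)
  qed (use \<delta> in simp)
  then have "exp (c * a * \<delta>) * y t \<le> y (t - \<delta>)"
    by (simp add: g_def right_diff_distrib exp_diff field_simps)
  moreover have "exp 1 * (c * a * \<delta>) \<le> exp (c * a * \<delta>)"
    using exp_ge_add_one_self[of "c * a * \<delta> - 1"] by (simp add: exp_diff field_simps)
  then have "exp 1 * (c * a * \<delta>) * y t \<le> exp (c * a * \<delta>) * y t"
    by (rule mult_right_mono) (use pos[of t] t\<delta> \<delta> in simp)
  ultimately show ?case by (simp add: a_def algebra_simps)
qed

lemma dde_positive_imp_delay_small:
  assumes dec: "\<And>a b. 0 \<le> a \<Longrightarrow> a \<le> b \<Longrightarrow> y b \<le> y a"
  shows "c * \<delta> \<le> 1 / exp 1"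
proof (rule ccontr)
  assume "\<not> c * \<delta> \<le> 1 / exp 1"
  then have "exp 1 * c * \<delta> > 1" by (simp add: field_simps)
  then obtain n where n: "(2 / (c * \<delta>))\<^sup>2 < (exp 1 * c * \<delta>) ^ n"
    using real_arch_pow by blast
  define t where "t = (real n + 2) * \<delta>"
  have t: "t \<ge> (real n + 1) * \<delta>" "t \<ge> 2 * \<delta>" and y: "y t > 0"
    using \<delta> by (auto simp: t_def intro!: mult_right_mono pos)
  have "(2 / (c * \<delta>))\<^sup>2 * y t < (exp 1 * c * \<delta>) ^ n * y t"
    by (rule mult_strict_right_mono[OF n y])
  also have "\<dots> \<le> y (t - \<delta>)" using dde_ratio_growth[OF dec t(1)] .
  also have "\<dots> \<le> (2 / (c * \<delta>))\<^sup>2 * y t" using dde_ratio_bounded[OF dec t(2)] .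
  finally show False by simp
qed

lemma dde_tendsto_0:
  assumes dec: "\<And>a b. 0 \<le> a \<Longrightarrow> a \<le> b \<Longrightarrow> y b \<le> y a"
  shows "(y \<longlongrightarrow> 0) at_top"
proof (rule tendstoI)
  fix e :: real assume e: "e > 0"
  \<comment> \<open>If \<open>y\<close> stayed above \<open>e\<close>, its slope would be at most \<open>- c e\<close> and it would reach \<open>0\<close> by time \<open>t\<close>.\<close>
  define t where "t = \<delta> + y \<delta> / (c * e)"
  have t: "t > \<delta>" using pos[of \<delta>] \<delta> c e by (simp add: t_def)
  have "\<exists>s\<ge>0. y s < e"
  proof (rule ccontr)
    assume "\<not> ?thesis"
    then have ge: "y s \<ge> e" if "s \<ge> 0" for s using that by force
    obtain z where z: "\<delta> < z" "y t - y \<delta> = (t - \<delta>) * (- c * y (z - \<delta>))"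
      using dde_mean_value[OF order_refl t] by blast
    have "(t - \<delta>) * (c * e) \<le> (t - \<delta>) * (c * y (z - \<delta>))"
      using z t c by (intro mult_left_mono ge) auto
    moreover have "(t - \<delta>) * (c * e) = y \<delta>" using c e by (simp add: t_def)
    ultimately have "y t \<le> 0" using z(2) by simp
    then show False using pos[of t] t \<delta> by simp
  qed
  then obtain s where s: "s \<ge> 0" "y s < e" by blast
  show "\<forall>\<^sub>F t in at_top. dist (y t) 0 < e"
    using eventually_ge_at_top[of s]
  proof eventually_elim
    case (elim t)
    then show ?case using dec[of s t] pos[of t] s by (simp add: dist_real_def)
  qed
qed

end

text \<open>The characteristic equation \<open>k exp (- k \<delta>) = c\<close> has a root in \<open>(0, 1 / \<delta>]\<close> by the intermediate
  value theorem, because the left-hand side equals \<open>1 / (e \<delta>) \<ge> c\<close> at \<open>k = 1 / \<delta>\<close>.\<close>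
lemma exponential_positive_solution:
  fixes c \<delta> :: real
  assumes c: "c > 0" and \<delta>: "\<delta> > 0" and small: "c * \<delta> \<le> 1 / exp 1"
  shows "positive_solutions c \<delta> \<noteq> {}"
proof -
  have "\<exists>x\<ge>0. x \<le> 1 / \<delta> \<and> x * exp (- x * \<delta>) = c"
  proof (rule IVT')
    show "c \<le> 1 / \<delta> * exp (- (1 / \<delta>) * \<delta>)"
      using small \<delta> by (simp add: exp_minus field_simps)
  qed (use c \<delta> in \<open>auto intro!: continuous_intros\<close>)
  then obtain k where k0: "k \<ge> 0" and k: "k * exp (- k * \<delta>) = c" by blast
  then have kpos: "k > 0" using c by (cases "k = 0") auto
  define y where "y = restrict (\<lambda>t. exp (- k * t)) {0..}"
  have ck: "c * exp (k * \<delta>) = k"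
    unfolding k[symmetric] by (simp add: exp_minus field_simps)
  have d: "(y has_real_derivative - c * y (t - \<delta>)) (at t within {\<delta>..})" if "t \<ge> \<delta>" for t
  proof (rule has_field_derivative_transform_within)
    have "- c * y (t - \<delta>) = - (c * exp (k * \<delta>)) * exp (- k * t)"
      using that by (simp add: y_def right_diff_distrib exp_diff exp_minus field_simps)
    also have "\<dots> = - k * exp (- k * t)" by (simp add: ck)
    finally have "- c * y (t - \<delta>) = - k * exp (- k * t)" .
    then show "((\<lambda>t. exp (- k * t)) has_real_derivative - c * y (t - \<delta>)) (at t within {\<delta>..})"
      by (auto intro!: derivative_eq_intros)
    show "\<delta> > 0" by fact
  qed (use that \<delta> in \<open>auto simp: y_def\<close>)
  have sol: "ivp_solution c \<delta> (restrict y {0..\<delta>}) y"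
    unfolding ivp_solution_def
  proof (intro conjI)
    show "y \<in> extensional {0..}" by (simp add: y_def)
    have "continuous_on {0..} (\<lambda>t. exp (- k * t))" by (intro continuous_intros)
    then show "continuous_on {0..} y" by (rule continuous_on_eq) (simp add: y_def)
  qed (use d in auto)
  moreover have "restrict y {0..\<delta>} \<in> init_funs \<delta>"
  proof -
    have "continuous_on {0..\<delta>} y"
      using sol unfolding ivp_solution_def by (auto intro: continuous_on_subset)
    then have "continuous_on {0..\<delta>} (restrict y {0..\<delta>})" by (rule continuous_on_eq) simp
    then show ?thesis
      using kpos \<delta> by (auto simp: init_funs_def monotone_on_def y_def)
  qed
  moreover have "\<forall>t\<ge>0. y t > 0" by (simp add: y_def)
  ultimately show ?thesis unfolding positive_solutions_def by blast
qed

section \<open>Distribution functions and solutions\<close>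

text \<open>Where \<open>g\<close> is nonzero it is nonzero on a neighbourhood, and a neighbourhood of a point of the
  support has positive mass.\<close>
lemma (in real_distribution) continuous_vanishing_AE_imp_on_supp:
  assumes g: "continuous_on UNIV g" and AE: "AE x in M. g x = (0::real)"
    and x: "x \<in> supp (cdf M)"
  shows "g x = 0"
proof (rule ccontr)
  assume "g x \<noteq> 0"
  have "open {z. g z \<noteq> 0}"
    by (intro open_Collect_neq g continuous_on_const)
  then obtain e where e: "e > 0" "\<And>z. dist z x < e \<Longrightarrow> g z \<noteq> 0"
    using \<open>g x \<noteq> 0\<close> unfolding open_dist by blast
  have "AE z in M. z \<notin> {x - e / 2<..x + e / 2}"
    using AE by eventually_elim (use e in \<open>force simp: dist_real_def\<close>)
  then have "prob {x - e / 2<..x + e / 2} = 0"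
    by (intro prob_eq_0[THEN iffD2]) auto
  moreover have "prob {x - e / 2<..x + e / 2} = cdf M (x + e / 2) - cdf M (x - e / 2)"
    using e by (intro cdf_diff_eq[symmetric]) simp
  ultimately show False
    using x e(1) unfolding supp_def by (smt (verit) half_gt_zero mem_Collect_eq)
qed

text \<open>Outside its support \<open>F\<close> is locally constant, hence constant on \<open>{..<a}\<close>, and the constant is the
  limit at minus infinity.\<close>
lemma cdf_vanishes_left_of_supp:
  fixes F :: "real \<Rightarrow> real"
  assumes mono: "\<And>x y. x \<le> y \<Longrightarrow> F x \<le> F y" and cont: "continuous_on UNIV F"
    and lim: "(F \<longlongrightarrow> 0) at_bot" and supp: "supp F \<subseteq> {a..}" and x: "x \<le> a"
  shows "F x = 0"
proof -
  have deriv: "(F has_real_derivative 0) (at z)" if "z < a" for z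
  proof -
    have "z \<notin> supp F" using supp that by auto
    then obtain e where e: "e > 0" "F (z + e) \<le> F (z - e)"
      by (auto simp: supp_def not_less)
    have "F w = F z" if "dist w z < e" for w
      using mono[of "z - e" w] mono[of w "z + e"] mono[of "z - e" z] mono[of z "z + e"] e that
      by (auto simp: dist_real_def abs_less_iff)
    then show ?thesis
      by (intro has_field_derivative_transform_within[OF DERIV_const e(1)]) auto
  qed
  have const: "F z = F a" if "z < a" for z
    using DERIV_isconst_end[OF that continuous_on_subset[OF cont subset_UNIV] deriv] by simp
  have "(F \<longlongrightarrow> F a) at_bot"
  proof (rule tendsto_eventually)
    show "\<forall>\<^sub>F z in at_bot. F z = F a"
      using eventually_gt_at_bot[of a] by eventually_elim (rule const)
  qed
  then have "F a = 0" using lim tendsto_unique trivial_limit_at_bot_linorder by blast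
  then show ?thesis using const[of x] x by (cases "x = a") auto
qed

text \<open>The drift equation at \<open>n = 1\<close> holds on the support of \<open>F\<close>, and its derivative is the delay
  differential equation.\<close>
lemma survival_function_positive_solution:
  assumes c: "c > 0" and \<delta>: "\<delta> > 0"
    and F: "F \<in> P_class c \<delta>" "continuous_on UNIV F" "supp F = {0..}"
  shows "restrict (\<lambda>t. 1 - F t) {0..} \<in> positive_solutions c \<delta>" and "t < 0 \<Longrightarrow> F t = 0"
proof -
  obtain M :: "(nat \<Rightarrow> real) measure" and X where iid: "iid_integrable M X F"
    and mart: "martingale M (nat_filtration M X)
        (\<lambda>n w. num_delta_records \<delta> X n w - c * running_max X n w)"
    using F(1) unfolding P_class_def by blast
  interpret prob_space M using iid by (simp add: iid_integrable_def)
  have X: "integrable M (X 1)" and Fcdf: "F = cdf (distr M borel (X 1))"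
    using iid by (auto simp: iid_integrable_def)
  then have Xm [measurable]: "X 1 \<in> borel_measurable M" by auto
  define \<mu> where "\<mu> = distr M borel (X 1)"
  interpret \<mu>: real_distribution \<mu>
    unfolding \<mu>_def by (rule real_distribution_distr) (rule Xm)
  have cdf: "cdf \<mu> = F" by (simp add: Fcdf \<mu>_def)
  have int: "integrable \<mu> (\<lambda>x. x)" unfolding \<mu>_def using X by (simp add: integrable_distr_eq)
  have contF: "isCont F x" for x using F(2) by (simp add: continuous_on_eq_continuous_at)
  have deriv_ex: "(\<mu>.mean_excess has_real_derivative - (1 - F m)) (at m)" for m
    using \<mu>.has_real_derivative_mean_excess[OF int] contF by (simp add: cdf)
  define g where "g m = 1 - F (m + \<delta>) - c * \<mu>.mean_excess m" for m
  have contg: "continuous_on UNIV g"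
  proof -
    have "continuous_on UNIV \<mu>.mean_excess"
      using deriv_ex DERIV_isCont continuous_at_imp_continuous_on by blast
    moreover have "continuous_on UNIV (\<lambda>m. F (m + \<delta>))"
      by (rule continuous_on_compose2[OF F(2)]) (auto intro!: continuous_intros)
    ultimately show ?thesis unfolding g_def by (intro continuous_intros)
  qed
  have "AE w in M. g (X 1 w) = 0"
    using mart[unfolded martingale_iff_drift_zero[OF iid], rule_format, of 1]
    by (simp add: g_def \<mu>.mean_excess_def \<mu>_def[symmetric] running_max_def del: One_nat_def)
  moreover have "{x. g x = 0} \<in> sets borel"
    by (intro borel_closed closed_Collect_eq contg continuous_on_const)
  ultimately have AE_g: "AE x in \<mu>. g x = 0"
    unfolding \<mu>_def using AE_distr_iff[OF Xm, of "\<lambda>x. g x = 0"] by simp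
  have g0: "g m = 0" if "m \<ge> 0" for m
    by (rule \<mu>.continuous_vanishing_AE_imp_on_supp[OF contg AE_g]) (use F(3) that cdf in simp)
  have surv: "1 - F t = c * \<mu>.mean_excess (t - \<delta>)" if "t \<ge> \<delta>" for t
    using g0[of "t - \<delta>"] that by (simp add: g_def)
  have mono: "F a \<le> F b" if "a \<le> b" for a b
    using \<mu>.cdf_nondecreasing[OF that] by (simp add: cdf)
  have neg: "F t = 0" if "t \<le> 0" for t
    by (rule cdf_vanishes_left_of_supp[OF mono F(2) _ _ that])
      (use \<mu>.cdf_lim_at_bot cdf F(3) in auto)
  then show "t < 0 \<Longrightarrow> F t = 0" by simp
  have strict: "F a < F b" if "0 \<le> a" "a < b" for a b
  proof -
    \<comment> \<open>The midpoint of \<open>[a, b]\<close> lies in the support, so \<open>F\<close> grows across the interval.\<close>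
    have "(a + b) / 2 \<in> supp F" using that F(3) by simp
    then have "F ((a + b) / 2 + (b - a) / 2) - F ((a + b) / 2 - (b - a) / 2) > 0"
      using that unfolding supp_def by (auto simp del: diff_gt_0_iff_gt)
    moreover have "(a + b) / 2 + (b - a) / 2 = b" "(a + b) / 2 - (b - a) / 2 = a"
      by (simp_all add: field_simps)
    ultimately show ?thesis by simp
  qed
  have pos: "F t < 1" if "t \<ge> 0" for t
    using strict[of t "t + 1"] that \<mu>.cdf_bounded_prob[of "t + 1"] by (simp add: cdf)
  let ?y = "restrict (\<lambda>t. 1 - F t) {0..}"
  have contS: "continuous_on A (\<lambda>t. 1 - F t)" for A
    by (intro continuous_intros continuous_on_subset[OF F(2)]) simp
  have "restrict ?y {0..\<delta>} \<in> init_funs \<delta>"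
  proof -
    have "continuous_on {0..\<delta>} (restrict ?y {0..\<delta>})"
      by (rule continuous_on_eq[OF contS]) simp
    then show ?thesis
      using strict neg[of 0] pos[of \<delta>] \<delta> by (auto simp: init_funs_def monotone_on_def)
  qed
  moreover have "ivp_solution c \<delta> (restrict ?y {0..\<delta>}) ?y"
    unfolding ivp_solution_def
  proof (intro conjI allI impI)
    show "continuous_on {0..} ?y" by (rule continuous_on_eq[OF contS]) simp
    fix t assume t: "\<delta> \<le> t"
    have "((\<lambda>t. c * \<mu>.mean_excess (t - \<delta>)) has_real_derivative - c * ?y (t - \<delta>)) (at t)"
      using t by (auto intro!: derivative_eq_intros DERIV_chain'[OF _ deriv_ex] simp: algebra_simps)
    then show "(?y has_real_derivative - c * ?y (t - \<delta>)) (at t within {\<delta>..})"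
      by (rule has_field_derivative_transform_within[OF has_field_derivative_at_within zero_less_one])
        (use t \<delta> surv in auto)
  qed auto
  ultimately show "?y \<in> positive_solutions c \<delta>"
    unfolding positive_solutions_def using pos by auto
qed

lemma iid_integrable_coordinates:
  assumes "real_distribution \<mu>" "integrable \<mu> (\<lambda>x. x)"
  shows "iid_integrable (PiM UNIV (\<lambda>_. \<mu>)) (\<lambda>n w. w n) (cdf \<mu>)"
    and "distr (PiM UNIV (\<lambda>_. \<mu>)) borel (\<lambda>w. w (n::nat)) = \<mu>"
proof -
  interpret real_distribution \<mu> by fact
  let ?P = "PiM UNIV (\<lambda>_. \<mu>) :: (nat \<Rightarrow> real) measure"
  interpret P: prob_space ?P by (rule prob_space_PiM) (rule prob_space_axioms)
  have sets_P: "sets ?P = sets (PiM UNIV (\<lambda>_. borel))"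
    by (rule sets_PiM_cong) simp_all
  have coord [measurable]: "(\<lambda>w. w n) \<in> borel_measurable ?P" for n
    by (subst measurable_cong_sets[OF sets_P refl]) simp
  have distr: "distr ?P borel (\<lambda>w. w n) = \<mu>" for n
  proof -
    have "distr ?P borel (\<lambda>w. w n) = distr ?P \<mu> (\<lambda>w. w n)"
      by (rule distr_cong) simp_all
    then show ?thesis
      using distr_PiM_component[of UNIV "\<lambda>_. \<mu>" n] prob_space_axioms by simp
  qed
  then show "distr ?P borel (\<lambda>w. w n) = \<mu>" .
  have "distr ?P (PiM UNIV (\<lambda>_. borel)) (\<lambda>w. \<lambda>i\<in>UNIV. w i) = ?P"
    by (simp add: restrict_def distr_id2[OF sets_P[symmetric], unfolded id_def])
  then have "P.indep_vars (\<lambda>_. borel) (\<lambda>n w. w n) UNIV"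
    by (subst P.indep_vars_iff_distr_eq_PiM) (simp_all add: distr)
  then have "P.indep_vars (\<lambda>_. borel) (\<lambda>n w. w n) {1..}"
    by (rule P.indep_vars_subset) simp
  moreover have "integrable ?P (\<lambda>w. w n)" for n
  proof -
    have "integrable (distr ?P borel (\<lambda>w. w n)) (\<lambda>x. x)" using assms(2) by (simp add: distr)
    then show ?thesis by (simp add: integrable_distr_eq)
  qed
  ultimately show "iid_integrable ?P (\<lambda>n w. w n) (cdf \<mu>)"
    unfolding iid_integrable_def using P.prob_space_axioms by (simp add: distr del: One_nat_def)
qed

text \<open>The point is that \<open>1 - y\<close> has a finite mean and satisfies the drift equation. Both come from the
  constancy of \<open>y (s + \<delta>) + c T s\<close>, where \<open>T\<close> is the truncated mean.\<close>
lemma positive_solution_distribution: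
  fixes y :: "real \<Rightarrow> real"
  defines "F \<equiv> (\<lambda>t. if 0 \<le> t then 1 - y t else 0)"
  assumes c: "c > 0" and \<delta>: "\<delta> > 0" and y: "y \<in> positive_solutions c \<delta>"
  shows "F \<in> P_class c \<delta>" "continuous_on UNIV F" "supp F = {0..}"
proof -
  note y_props = positive_solutionsD[OF y \<delta>]
  have cont: "continuous_on {0..} y" and y0: "y 0 = 1" and pos: "\<And>t. t \<ge> 0 \<Longrightarrow> y t > 0"
    and deriv: "\<And>t. t > \<delta> \<Longrightarrow> (y has_real_derivative - c * y (t - \<delta>)) (at t)"
    using y_props by blast+
  have strict: "y b < y a" if "0 \<le> a" "a < b" for a b
    using dde_strict_decreasing[OF c \<delta> cont pos deriv y_props(3)] that by blast
  have dec: "y b \<le> y a" if "0 \<le> a" "a \<le> b" for a b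
    using strict[of a b] that by (cases "a = b") auto
  have lim: "(y \<longlongrightarrow> 0) at_top"
    using dde_tendsto_0[OF c \<delta> cont pos deriv dec] by blast
  show contF: "continuous_on UNIV F"
  proof -
    have "continuous_on UNIV (\<lambda>t. if t \<le> 0 then 0 else 1 - y t)"
      by (rule continuous_on_cases_le)
        (auto intro!: continuous_intros continuous_on_subset[OF cont] simp: y0)
    moreover have "F = (\<lambda>t. if t \<le> 0 then 0 else 1 - y t)"
      by (auto simp: F_def y0 fun_eq_iff)
    ultimately show ?thesis by simp
  qed
  have le1: "y t \<le> 1" if "t \<ge> 0" for t using dec[of 0 t] that y0 by simp
  have mono: "F a \<le> F b" if "a \<le> b" for a b
    using dec[of a b] le1[of b] that by (auto simp: F_def)
  have strictF: "F a < F b" if "a < b" "0 < b" for a b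
    using strict[of a b] strict[of 0 b] that y0 by (auto simp: F_def)
  show "supp F = {0..}"
  proof (intro set_eqI iffI)
    fix x assume "x \<in> supp F"
    then have "F (x + \<epsilon>) - F (x - \<epsilon>) > 0" if "\<epsilon> > 0" for \<epsilon> using that by (simp add: supp_def)
    \<comment> \<open>For negative \<open>x\<close> this radius keeps the neighbourhood of \<open>x\<close> inside the negative half-line.\<close>
    from this[of "- x / 2"] show "x \<in> {0..}"
      by (cases "x < 0") (auto simp: F_def)
  qed (auto simp: supp_def intro!: strictF)
  define \<mu> where "\<mu> = interval_measure F"
  have limF0: "(F \<longlongrightarrow> 0) at_bot"
  proof (rule tendsto_eventually)
    show "\<forall>\<^sub>F t in at_bot. F t = 0"
      using eventually_gt_at_bot[of 0] by eventually_elim (simp add: F_def)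
  qed
  have limF1: "(F \<longlongrightarrow> 1) at_top"
  proof -
    have "((\<lambda>t. 1 - y t) \<longlongrightarrow> 1 - 0) at_top" by (intro tendsto_intros lim)
    moreover have "\<forall>\<^sub>F t in at_top. 1 - y t = F t"
      using eventually_ge_at_top[of 0] by eventually_elim (simp add: F_def)
    ultimately show ?thesis by (simp add: filterlim_cong)
  qed
  have right: "continuous (at_right a) F" for a
    using contF by (simp add: continuous_on_eq_continuous_at continuous_at_imp_continuous_at_within)
  interpret real_distribution \<mu>
    unfolding \<mu>_def by (rule real_distribution_interval_measure[OF mono right limF0 limF1])
  have cdf: "cdf \<mu> = F"
    unfolding \<mu>_def by (rule cdf_interval_measure[OF mono right limF0])
  have contF': "isCont (cdf \<mu>) x" for x
    using contF by (simp add: cdf continuous_on_eq_continuous_at)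
  have AE_pos: "AE x in \<mu>. 0 \<le> x"
  proof -
    have "prob {..0} = 0" using fun_cong[OF cdf, of 0] y0 by (simp add: cdf_def F_def)
    then have "AE x in \<mu>. x \<notin> {..0}" by (subst (asm) prob_eq_0) auto
    then show ?thesis by eventually_elim auto
  qed
  have T: "truncated_mean s = (y \<delta> - y (s + \<delta>)) / c" if s: "s \<ge> 0" for s
  proof (cases "s = 0")
    case False
    let ?h = "\<lambda>s. y (s + \<delta>) + c * truncated_mean s"
    have "?h s = ?h 0"
    proof (rule DERIV_isconst_end[where f = ?h])
      have dT: "(truncated_mean has_real_derivative 1 - F x) (at x)" for x
        using has_real_derivative_truncated_mean[OF contF'] by (simp add: cdf)
      have "continuous_on {0..s} truncated_mean"
        using dT DERIV_isCont continuous_at_imp_continuous_on by blast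
      moreover have "continuous_on {0..s} (\<lambda>s. y (s + \<delta>))"
        by (rule continuous_on_compose2[OF cont]) (use \<delta> in \<open>auto intro!: continuous_intros\<close>)
      ultimately show "continuous_on {0..s} ?h" by (intro continuous_intros)
      fix x :: real assume x: "0 < x" "x < s"
      have "((\<lambda>s. y (s + \<delta>)) has_real_derivative - c * y x) (at x)"
        using DERIV_shift[of y "- c * y x" x \<delta>] deriv[of "x + \<delta>"] x by simp
      from DERIV_add[OF this DERIV_cmult[OF dT, of c]] show "(?h has_real_derivative 0) (at x)"
        using x by (simp add: F_def)
    qed (use False s in simp)
    then show ?thesis using c by (simp add: field_simps)
  qed simp
  have lim_shift: "((\<lambda>s. y (s + \<delta>)) \<longlongrightarrow> 0) at_top"
  proof -
    have "filterlim (\<lambda>s. \<delta> + s) at_top at_top"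
      by (rule filterlim_tendsto_add_at_top[OF tendsto_const filterlim_ident])
    from filterlim_compose[OF lim this] show ?thesis by (simp add: add.commute)
  qed
  have limT: "(truncated_mean \<longlongrightarrow> y \<delta> / c) at_top"
  proof -
    have "((\<lambda>s. (y \<delta> - y (s + \<delta>)) / c) \<longlongrightarrow> (y \<delta> - 0) / c) at_top"
      using c by (intro tendsto_intros lim_shift) simp
    moreover have "\<forall>\<^sub>F s in at_top. (y \<delta> - y (s + \<delta>)) / c = truncated_mean s"
      using eventually_ge_at_top[of 0] by eventually_elim (simp add: T)
    ultimately show ?thesis by (simp add: filterlim_cong)
  qed
  have int: "integrable \<mu> (\<lambda>x. x)" and ex0: "mean_excess 0 = y \<delta> / c"
    using truncated_mean_limit[OF AE_pos limT] by auto
  have ex: "1 - F (m + \<delta>) = c * mean_excess m" if "m \<ge> 0" for m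
    using mean_excess_eq[OF int, of m] T[OF that] that c \<delta>
    by (simp add: ex0 F_def field_simps)
  let ?P = "PiM UNIV (\<lambda>_. \<mu>) :: (nat \<Rightarrow> real) measure"
  let ?X = "\<lambda>n w. w n"
  have iid: "iid_integrable ?P ?X F"
    using iid_integrable_coordinates(1)[OF real_distribution_axioms int] by (simp add: cdf)
  have law: "distr ?P borel (?X n) = \<mu>" for n
    by (rule iid_integrable_coordinates(2)[OF real_distribution_axioms int])
  have "martingale ?P (nat_filtration ?P ?X)
      (\<lambda>n w. num_delta_records \<delta> ?X n w - c * running_max ?X n w)"
    unfolding martingale_iff_drift_zero[OF iid]
  proof (intro allI impI)
    fix n :: nat assume n: "n \<ge> 1"
    have "AE w in ?P. 0 \<le> w 1"
      by (rule AE_PiM_component[where P = "\<lambda>x. 0 \<le> x"]) (use AE_pos prob_space_axioms in auto)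
    then show "AE w in ?P. 1 - F (running_max ?X n w + \<delta>)
        = c * (\<integral>x. max 0 (x - running_max ?X n w) \<partial>distr ?P borel (?X 1))"
    proof eventually_elim
      case (elim w)
      have "w 1 \<le> running_max ?X n w"
        unfolding running_max_def using n by (intro Max_ge) auto
      then show ?case using ex[of "running_max ?X n w"] elim by (simp add: law mean_excess_def)
    qed
  qed
  moreover have "F 1 \<noteq> 0" "F 1 \<noteq> 1"
    using strict[of 0 1] y0 pos[of 1] by (auto simp: F_def)
  then have "\<not> degenerate F" unfolding degenerate_def by metis
  ultimately show "F \<in> P_class c \<delta>"
    unfolding P_class_def using iid by blast
qed

theorem theorem5:
  fixes c \<delta> :: real
  assumes "c > 0" and "\<delta> > 0"
  shows "bij_betw (\<lambda>y t. if 0 \<le> t then 1 - y t else 0)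
           (positive_solutions c \<delta>)
           {F \<in> P_class c \<delta>. continuous_on UNIV F \<and> supp F = {0..}}
       \<and> ((\<exists>F \<in> P_class c \<delta>. continuous_on UNIV F \<and> supp F = {0..}) \<longleftrightarrow> c * \<delta> \<le> 1 / exp 1)"
proof -
  let ?f = "\<lambda>(y :: real \<Rightarrow> real) t. if 0 \<le> t then 1 - y t else (0 :: real)"
  let ?D = "{F \<in> P_class c \<delta>. continuous_on UNIV F \<and> supp F = {0..}}"
  have bij: "bij_betw ?f (positive_solutions c \<delta>) ?D"
    unfolding bij_betw_def
  proof (intro conjI equalityI subsetI)
    show "inj_on ?f (positive_solutions c \<delta>)"
    proof (rule inj_onI)
      fix y z assume yz: "y \<in> positive_solutions c \<delta>" "z \<in> positive_solutions c \<delta>" and eq: "?f y = ?f z"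
      show "y = z"
      proof (rule extensionalityI)
        show "y \<in> extensional {0..}" "z \<in> extensional {0..}"
          using yz positive_solutionsD(1)[OF _ assms(2)] by auto
        show "y t = z t" if "t \<in> {0..}" for t
          using fun_cong[OF eq, of t] that by simp
      qed
    qed
  next
    fix F assume "F \<in> ?f ` positive_solutions c \<delta>"
    then show "F \<in> ?D" using positive_solution_distribution[OF assms] by blast
  next
    fix F assume F: "F \<in> ?D"
    have neg: "F t = 0" if "t < 0" for t
      by (rule survival_function_positive_solution(2)[OF assms _ _ _ that]) (use F in auto)
    have "restrict (\<lambda>t. 1 - F t) {0..} \<in> positive_solutions c \<delta>"
      by (rule survival_function_positive_solution(1)[OF assms]) (use F in auto)
    moreover have "F = ?f (restrict (\<lambda>t. 1 - F t) {0..})"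
      using neg by (auto simp: fun_eq_iff)
    ultimately show "F \<in> ?f ` positive_solutions c \<delta>"
      using image_eqI[of F ?f "restrict (\<lambda>t. 1 - F t) {0..}"] by blast
  qed
  have "(\<exists>F \<in> P_class c \<delta>. continuous_on UNIV F \<and> supp F = {0..}) \<longleftrightarrow> positive_solutions c \<delta> \<noteq> {}"
    using bij_betw_imp_surj_on[OF bij] by blast
  also have "\<dots> \<longleftrightarrow> c * \<delta> \<le> 1 / exp 1"
  proof
    assume "positive_solutions c \<delta> \<noteq> {}"
    then obtain y where "y \<in> positive_solutions c \<delta>" by blast
    note y = positive_solutionsD[OF this assms(2)]
    have "y b \<le> y a" if "0 \<le> a" "a \<le> b" for a b
      using dde_strict_decreasing[OF assms y(2,5,6,3), of a b] that by (cases "a = b") auto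
    then show "c * \<delta> \<le> 1 / exp 1"
      using dde_positive_imp_delay_small[OF assms y(2,5,6)] by blast
  qed (rule exponential_positive_solution[OF assms])
  finally show ?thesis using bij by blast
qed

end
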